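(* Let $E^{\mathrm{ce}}$ be an equivalence relation on $\omega$ extending $=^{\mathrm{ce}}$. A family $\mathfrak{K}$ of nonempty c.e. sets is $E^{\mathrm{ce}}$-learnable if and only if $\mathfrak{K}$ has no member that is $(\mathfrak{K},E^{\mathrm{ce}})$-absorbing.
   Context: Fix a standard (acceptable) enumeration $(\varphi_e)_{e\in\omega}$ of the partial computable functions and let $W_e=\operatorname{dom}(\varphi_e)$. Write $e=^{\mathrm{ce}}e'$ iff $W_e=W_{e'}$. Equivalence relations on $\omega$ extending $=^{\mathrm{ce}}$ are arbitrary (no definability or effectivity is assumed). An enumeration of a set $A$ is a surjection $\mu:\omega\to A$; $\mu[s]$ denotes the finite string $\mu(0),\dots,\mu(s-1)$. A learner is an arbitrary function $\mathbf{M}:\omega^{<\omega}\to\omega$ (no effectivity is assumed). A family $\mathfrak{K}$ of nonempty c.e. sets is $E^{\mathrm{ce}}$-learnable if there is a learner $\mathbf{M}$ such that for every $e$ with $W_e\in\mathfrak{K}$ and every enumeration $\mu$ of $W_e$ there is $i\in\omega$ with $i\mathrel{E^{\mathrm{ce}}}e$ and $\mathbf{M}(\mu[s])=i$ for all sufficiently large $s$. A set $W_e\in\mathfrak{K}$ is $(\mathfrak{K},E^{\mathrm{ce}})$-absorbing if for every finite set $F\subseteq W_e$ there exists $W_i\in\mathfrak{K}$ such that $i\mathrel{E^{\mathrm{ce}}}e$ fails and $F\subseteq W_i\subsetneq W_e$. *)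

theory Defs
  imports Complex_Main
begin

section \<open>Partial computable functions\<close>

fun prim_rec :: "(nat list \<rightharpoonup> nat) \<Rightarrow> (nat list \<rightharpoonup> nat) \<Rightarrow> nat \<Rightarrow> (nat list \<rightharpoonup> nat)" where
  "prim_rec f g 0 xs = f xs"
| "prim_rec f g (Suc y) xs = Option.bind (prim_rec f g y xs) (\<lambda>v. g (y # v # xs))"

text \<open>Unbounded search: the search also diverges if it meets an undefined value
  before the first zero.\<close>

definition mu_search :: "(nat \<rightharpoonup> nat) \<Rightarrow> nat option" where
  "mu_search p =
     (if \<exists>z. p z = Some 0 \<and> (\<forall>y<z. \<exists>v. p y = Some (Suc v))
      then Some (LEAST z. p z = Some 0) else None)"

text \<open>Kleene's partial (mu-)recursive functions. A function of arity \<open>n\<close> is represented on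
  argument lists; only its values on lists of length \<open>n\<close> are meaningful.\<close>

inductive mu_recursive :: "nat \<Rightarrow> (nat list \<rightharpoonup> nat) \<Rightarrow> bool" where
  zero: "mu_recursive n (\<lambda>xs. Some 0)"
| succ: "mu_recursive 1 (\<lambda>xs. Some (Suc (hd xs)))"
| proj: "i < n \<Longrightarrow> mu_recursive n (\<lambda>xs. Some (xs ! i))"
| comp: "mu_recursive (length gs) f \<Longrightarrow> (\<forall>g\<in>set gs. mu_recursive n g) \<Longrightarrow>
           mu_recursive n (\<lambda>xs. Option.bind (those (map (\<lambda>g. g xs) gs)) f)"
| prec: "mu_recursive n f \<Longrightarrow> mu_recursive (n + 2) g \<Longrightarrow>
           mu_recursive (Suc n) (\<lambda>xs. prim_rec f g (hd xs) (tl xs))"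
| mini: "mu_recursive (Suc n) f \<Longrightarrow> mu_recursive n (\<lambda>xs. mu_search (\<lambda>y. f (y # xs)))"

definition partial_computable :: "(nat \<rightharpoonup> nat) \<Rightarrow> bool" where
  "partial_computable f \<longleftrightarrow> (\<exists>g. mu_recursive 1 g \<and> (\<forall>x. g [x] = f x))"

definition partial_computable2 :: "(nat \<Rightarrow> nat \<rightharpoonup> nat) \<Rightarrow> bool" where
  "partial_computable2 f \<longleftrightarrow> (\<exists>g. mu_recursive 2 g \<and> (\<forall>x y. g [x, y] = f x y))"

definition total_computable :: "(nat \<Rightarrow> nat) \<Rightarrow> bool" where
  "total_computable f \<longleftrightarrow> partial_computable (\<lambda>x. Some (f x))"

text \<open>Acceptability in the sense of Rogers: an enumeration of exactly the unary partial
  computable functions with a partial computable universal function and the s-m-n property.\<close>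

definition acceptable :: "(nat \<Rightarrow> nat \<rightharpoonup> nat) \<Rightarrow> bool" where
  "acceptable \<phi> \<longleftrightarrow>
     range \<phi> = Collect partial_computable \<and>
     partial_computable2 \<phi> \<and>
     (\<forall>\<psi>. partial_computable2 \<psi> \<longrightarrow> (\<exists>f. total_computable f \<and> (\<forall>e. \<phi> (f e) = \<psi> e)))"

section \<open>C.e. sets and learnability\<close>

definition ce :: "nat set \<Rightarrow> bool" where
  "ce A \<longleftrightarrow> (\<exists>f. partial_computable f \<and> A = dom f)"

definition W :: "(nat \<Rightarrow> nat \<rightharpoonup> nat) \<Rightarrow> nat \<Rightarrow> nat set" where
  "W \<phi> e = dom (\<phi> e)"

definition ce_eq :: "(nat \<Rightarrow> nat \<rightharpoonup> nat) \<Rightarrow> nat rel" where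
  "ce_eq \<phi> = {(e, e'). W \<phi> e = W \<phi> e'}"

definition enumeration_of :: "(nat \<Rightarrow> nat) \<Rightarrow> nat set \<Rightarrow> bool" where
  "enumeration_of \<mu> A \<longleftrightarrow> range \<mu> = A"

definition init_seg :: "(nat \<Rightarrow> nat) \<Rightarrow> nat \<Rightarrow> nat list" where
  "init_seg \<mu> s = map \<mu> [0..<s]"

definition learnable :: "(nat \<Rightarrow> nat \<rightharpoonup> nat) \<Rightarrow> nat rel \<Rightarrow> nat set set \<Rightarrow> bool" where
  "learnable \<phi> E K \<longleftrightarrow>
     (\<exists>M :: nat list \<Rightarrow> nat. \<forall>e \<mu>. W \<phi> e \<in> K \<longrightarrow> enumeration_of \<mu> (W \<phi> e) \<longrightarrow>
        (\<exists>i. (i, e) \<in> E \<and> (\<forall>\<^sub>F s in sequentially. M (init_seg \<mu> s) = i)))"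

text \<open>Being absorbing is stated for an index \<open>e\<close> of the set; it depends only on \<open>W \<phi> e\<close>
  when \<open>E\<close> is an equivalence relation extending \<^term>\<open>ce_eq \<phi>\<close>.\<close>

definition absorbing :: "(nat \<Rightarrow> nat \<rightharpoonup> nat) \<Rightarrow> nat rel \<Rightarrow> nat set set \<Rightarrow> nat \<Rightarrow> bool" where
  "absorbing \<phi> E K e \<longleftrightarrow>
     W \<phi> e \<in> K \<and>
     (\<forall>F. finite F \<longrightarrow> F \<subseteq> W \<phi> e \<longrightarrow>
        (\<exists>i. W \<phi> i \<in> K \<and> (i, e) \<notin> E \<and> F \<subseteq> W \<phi> i \<and> W \<phi> i \<subset> W \<phi> e))"

end

theory Submission
  imports Defs
begin

text \<open>A learner that succeeds on \<open>W\<^sub>e\<close> has a locking sequence \<open>\<sigma>\<close>, i.e. a string over \<open>W\<^sub>e\<close> after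
  which it never changes its mind as long as it sees elements of \<open>W\<^sub>e\<close>. The content of \<open>\<sigma>\<close> is a
  finite set witnessing that \<open>W\<^sub>e\<close> is not absorbing: a member \<open>W\<^sub>i\<close> between this set and \<open>W\<^sub>e\<close> has an
  enumeration beginning with \<open>\<sigma>\<close>, on which the learner is locked to its conjecture for \<open>W\<^sub>e\<close>.
  Conversely, if no member is absorbing, choose for every \<open>W\<^sub>e \<in> K\<close> a finite set \<open>F\<^sub>e\<close> refuting
  absorption; the learner conjecturing the least \<open>j\<close> with \<open>F\<^sub>j \<subseteq> content \<sigma> \<subseteq> W\<^sub>j\<close>
  converges to the least \<open>j\<close> with \<open>F\<^sub>j \<subseteq> W\<^sub>e \<subseteq> W\<^sub>j\<close>.\<close>

lemma set_init_seg: "set (init_seg \<mu> s) = \<mu> ` {..<s}"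
  by (auto simp: init_seg_def)

lemma enumeration_of_exists:
  assumes "A \<noteq> {}"
  shows "\<exists>a. enumeration_of a A"
proof -
  obtain x where "x \<in> A" using assms by blast
  then have "range (\<lambda>n. if n \<in> A then n else x) = A" by auto
  then show ?thesis unfolding enumeration_of_def by blast
qed

text \<open>Enumerations may repeat values, so \<open>a\<close> can be shifted behind any string
  over \<open>A\<close>.\<close>

lemma enumeration_of_append:
  assumes "set \<sigma> \<subseteq> A" and "enumeration_of a A"
  obtains \<mu> where "enumeration_of \<mu> A"
    and "\<And>s. init_seg \<mu> (length \<sigma> + s) = \<sigma> @ init_seg a s"
proof
  define \<mu> where "\<mu> n = (if n < length \<sigma> then \<sigma> ! n else a (n - length \<sigma>))" for n
  have "\<mu> n \<in> A" for n
    using assms nth_mem[of n \<sigma>] by (auto simp: \<mu>_def enumeration_of_def)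
  moreover have "\<mu> (length \<sigma> + n) = a n" for n
    by (simp add: \<mu>_def)
  then have "range a \<subseteq> range \<mu>" by (metis image_subsetI rangeI)
  ultimately show "enumeration_of \<mu> A"
    using assms(2) by (auto simp: enumeration_of_def)
  show "init_seg \<mu> (length \<sigma> + s) = \<sigma> @ init_seg a s" for s
    by (rule nth_equalityI) (auto simp: init_seg_def \<mu>_def nth_append)
qed

text \<open>Otherwise every string over \<open>A\<close> has an extension over \<open>A\<close> that
  changes the conjecture. Chaining such extensions, with all elements of \<open>A\<close> mixed in,
  gives an enumeration of \<open>A\<close> on which \<open>M\<close> diverges.\<close>

lemma locking_sequence:
  assumes "A \<noteq> {}"
    and conv: "\<And>\<mu>. enumeration_of \<mu> A \<Longrightarrow> \<exists>i. \<forall>\<^sub>F s in sequentially. M (init_seg \<mu> s) = i"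
  obtains \<sigma> where "set \<sigma> \<subseteq> A" and "\<And>\<tau>. set \<tau> \<subseteq> A \<Longrightarrow> M (\<sigma> @ \<tau>) = M \<sigma>"
proof (rule ccontr)
  assume "\<not> thesis"
  then have "\<forall>\<sigma>. \<exists>\<tau>. set \<sigma> \<subseteq> A \<longrightarrow> set \<tau> \<subseteq> A \<and> M (\<sigma> @ \<tau>) \<noteq> M \<sigma>"
    using that by metis
  then obtain ext where ext:
    "\<And>\<sigma>. set \<sigma> \<subseteq> A \<Longrightarrow> set (ext \<sigma>) \<subseteq> A \<and> M (\<sigma> @ ext \<sigma>) \<noteq> M \<sigma>" by metis
  obtain a :: "nat \<Rightarrow> nat" where a: "range a = A"
    using enumeration_of_exists[OF assms(1)] unfolding enumeration_of_def by blast
  \<comment> \<open>Stage \<open>n\<close> forces a mind change through \<open>ext\<close>; the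
    entry \<open>a n\<close> makes the limit exhaust \<open>A\<close> and the lengths grow.\<close>
  define L where "L = rec_nat [] (\<lambda>n \<sigma>. \<sigma> @ ext \<sigma> @ [a n])"
  have L_Suc: "L (Suc n) = L n @ ext (L n) @ [a n]" for n
    by (simp add: L_def)
  have L_set: "set (L n) \<subseteq> A" for n
  proof (induction n)
    case 0
    then show ?case by (simp add: L_def)
  next
    case (Suc n)
    then show ?case using ext[OF Suc] a by (auto simp: L_Suc)
  qed
  have L_len: "n \<le> length (L n)" for n
    by (induction n) (auto simp: L_Suc)
  have L_prefix: "\<exists>zs. L n = L m @ zs" if "m \<le> n" for m n
    using that by (induction rule: dec_induct) (auto simp: L_Suc)
  \<comment> \<open>The limit of the chain: \<open>L (Suc k)\<close> has an entry at position
    \<open>k\<close>, and all later stages agree with it there.\<close>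
  define \<mu> where "\<mu> k = L (Suc k) ! k" for k
  have \<mu>_nth: "\<mu> k = L n ! k" if k: "k < length (L n)" for k n
  proof -
    have k': "k < length (L (Suc k))"
      using L_len[of "Suc k"] by simp
    consider zs where "L (Suc k) = L n @ zs" | zs where "L n = L (Suc k) @ zs"
      using L_prefix nat_le_linear by metis
    then show ?thesis
    proof cases
      case 1
      then show ?thesis unfolding \<mu>_def using k by (metis nth_append_left)
    next
      case 2
      then show ?thesis unfolding \<mu>_def using k' by (metis nth_append_left)
    qed
  qed
  have \<mu>_init: "init_seg \<mu> (length xs) = xs" if "L n = xs @ ys" for xs ys n
  proof (rule nth_equalityI)
    fix k assume "k < length (init_seg \<mu> (length xs))"
    then show "init_seg \<mu> (length xs) ! k = xs ! k"
      using \<mu>_nth[of k n] that by (simp add: init_seg_def nth_append)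
  qed (simp add: init_seg_def)
  have "\<mu> k \<in> A" for k
    using L_len[of "Suc k"] L_set[of "Suc k"] nth_mem[of k "L (Suc k)"] by (auto simp: \<mu>_def)
  moreover have "a n \<in> range \<mu>" for n
  proof -
    have "a n \<in> set (L (Suc n))" by (simp add: L_Suc)
    then obtain k where "k < length (L (Suc n))" "L (Suc n) ! k = a n"
      by (auto simp: in_set_conv_nth)
    then show ?thesis using \<mu>_nth by (metis rangeI)
  qed
  ultimately have "enumeration_of \<mu> A"
    using a by (auto simp: enumeration_of_def)
  then obtain i N where N: "\<And>s. s \<ge> N \<Longrightarrow> M (init_seg \<mu> s) = i"
    using conv unfolding eventually_sequentially by blast
  \<comment> \<open>\<open>L N\<close> and \<open>L N @ ext (L N)\<close> are both initial segments
    of \<open>\<mu>\<close> of length at least \<open>N\<close>, yet \<open>ext\<close> makes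
    \<open>M\<close> differ on them.\<close>
  have "M (L N) = i"
    using N[OF L_len] \<mu>_init[of N "L N" "[]"] by simp
  moreover have "M (L N @ ext (L N)) = i"
    using N[of "length (L N @ ext (L N))"] L_len[of N]
      \<mu>_init[of "Suc N" "L N @ ext (L N)" "[a N]"] by (simp add: L_Suc)
  ultimately show False using ext[OF L_set[of N]] by simp
qed

lemma learnable_imp_not_absorbing:
  assumes E: "equiv UNIV E" and ne: "\<forall>A\<in>K. A \<noteq> {}" and "learnable \<phi> E K"
  shows "\<not> absorbing \<phi> E K e"
proof
  assume abs: "absorbing \<phi> E K e"
  obtain M where M: "\<And>e \<mu>. W \<phi> e \<in> K \<Longrightarrow> enumeration_of \<mu> (W \<phi> e) \<Longrightarrow>
      \<exists>i. (i, e) \<in> E \<and> (\<forall>\<^sub>F s in sequentially. M (init_seg \<mu> s) = i)"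
    using assms(3) unfolding learnable_def by blast
  have e: "W \<phi> e \<in> K" using abs by (simp add: absorbing_def)
  obtain \<sigma> where \<sigma>: "set \<sigma> \<subseteq> W \<phi> e"
    and lock: "\<And>\<tau>. set \<tau> \<subseteq> W \<phi> e \<Longrightarrow> M (\<sigma> @ \<tau>) = M \<sigma>"
    using locking_sequence[of "W \<phi> e" M] ne e M[OF e] by metis
  \<comment> \<open>Used for \<open>j = i\<close> and for \<open>j = e\<close>: the single
    conjecture \<open>M \<sigma>\<close> then links \<open>i\<close> to \<open>e\<close>.\<close>
  have correct: "(M \<sigma>, j) \<in> E"
    if j: "W \<phi> j \<in> K" and sub: "set \<sigma> \<subseteq> W \<phi> j" "W \<phi> j \<subseteq> W \<phi> e" for j
  proof -
    obtain a where a: "enumeration_of a (W \<phi> j)"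
      using enumeration_of_exists ne j by metis
    obtain \<mu> where \<mu>: "enumeration_of \<mu> (W \<phi> j)"
      and init: "\<And>s. init_seg \<mu> (length \<sigma> + s) = \<sigma> @ init_seg a s"
      using enumeration_of_append[OF sub(1) a] by blast
    obtain i N where i: "(i, j) \<in> E" and N: "\<And>s. s \<ge> N \<Longrightarrow> M (init_seg \<mu> s) = i"
      using M[OF j \<mu>] unfolding eventually_sequentially by blast
    have "set (init_seg a N) \<subseteq> W \<phi> e"
      using a sub(2) by (auto simp: set_init_seg enumeration_of_def)
    then have "M \<sigma> = i"
      using lock N[of "length \<sigma> + N"] init by simp
    then show ?thesis using i by simp
  qed
  obtain i where i: "W \<phi> i \<in> K" "(i, e) \<notin> E" "set \<sigma> \<subseteq> W \<phi> i" "W \<phi> i \<subset> W \<phi> e"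
    using abs \<sigma> unfolding absorbing_def by (meson finite_set)
  have "(M \<sigma>, i) \<in> E" "(M \<sigma>, e) \<in> E"
    using correct i e \<sigma> by auto
  then have "(i, e) \<in> E"
    using E by (meson equivE symD transD)
  then show False using i by simp
qed

lemma not_absorbing_imp_learnable:
  assumes E: "equiv UNIV E" and ext: "ce_eq \<phi> \<subseteq> E" and "\<And>e. \<not> absorbing \<phi> E K e"
  shows "learnable \<phi> E K"
proof -
  have "\<forall>e. \<exists>F. W \<phi> e \<in> K \<longrightarrow> finite F \<and> F \<subseteq> W \<phi> e \<and>
      (\<forall>i. W \<phi> i \<in> K \<longrightarrow> F \<subseteq> W \<phi> i \<longrightarrow> W \<phi> i \<subset> W \<phi> e \<longrightarrow> (i, e) \<in> E)"
    using assms(3) unfolding absorbing_def by meson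
  then obtain F where F: "\<And>e. W \<phi> e \<in> K \<Longrightarrow> finite (F e) \<and> F e \<subseteq> W \<phi> e \<and>
      (\<forall>i. W \<phi> i \<in> K \<longrightarrow> F e \<subseteq> W \<phi> i \<longrightarrow> W \<phi> i \<subset> W \<phi> e \<longrightarrow> (i, e) \<in> E)"
    by metis
  \<comment> \<open>\<open>C\<close> is the content of a finite string for the learner, and all of
    \<open>W \<phi> e\<close> for its limit.\<close>
  define P where "P C j \<longleftrightarrow> W \<phi> j \<in> K \<and> F j \<subseteq> C \<and> C \<subseteq> W \<phi> j" for C j
  \<comment> \<open>Where no index satisfies \<open>P\<close>, the value is arbitrary;
    \<open>valid\<close> below shows that this eventually stops.\<close>
  define M where "M \<sigma> = (LEAST j. P (set \<sigma>) j)" for \<sigma>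
  have "\<exists>i. (i, e) \<in> E \<and> (\<forall>\<^sub>F s in sequentially. M (init_seg \<mu> s) = i)"
    if e: "W \<phi> e \<in> K" and \<mu>: "enumeration_of \<mu> (W \<phi> e)" for e \<mu>
  proof -
    have rng: "range \<mu> = W \<phi> e" using \<mu> by (simp add: enumeration_of_def)
    define j where "j = (LEAST j. P (W \<phi> e) j)"
    have "P (W \<phi> e) e" using F[OF e] e by (simp add: P_def)
    then have j: "P (W \<phi> e) j" unfolding j_def by (rule LeastI)
    \<comment> \<open>If the sets differ, \<open>W \<phi> e\<close> lies properly below
      \<open>W \<phi> j\<close> and contains \<open>F j\<close>, so the choice of \<open>F j\<close>
      applies.\<close>
    have "(e, j) \<in> E"
    proof (cases "W \<phi> e = W \<phi> j")
      case True
      then show ?thesis using ext by (auto simp: ce_eq_def)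
    next
      case False
      then show ?thesis using F[of j] j e by (auto simp: P_def)
    qed
    then have "(j, e) \<in> E" using E by (meson equivE symD)
    have enum: "\<forall>\<^sub>F s in sequentially. x \<in> set (init_seg \<mu> s)" if x: "x \<in> W \<phi> e" for x
    proof -
      obtain k where k: "x = \<mu> k" using x rng by blast
      show ?thesis
        using eventually_gt_at_top[of k] by eventually_elim (simp add: k set_init_seg)
    qed
    have sub: "set (init_seg \<mu> s) \<subseteq> W \<phi> e" for s
      using rng by (auto simp: set_init_seg)
    have "\<forall>\<^sub>F s in sequentially. \<forall>x\<in>F j. x \<in> set (init_seg \<mu> s)"
    proof (rule eventually_ball_finite)
      show "finite (F j)" using F j by (simp add: P_def)
      show "\<forall>x\<in>F j. \<forall>\<^sub>F s in sequentially. x \<in> set (init_seg \<mu> s)"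
        using enum j by (auto simp: P_def)
    qed
    then have valid: "\<forall>\<^sub>F s in sequentially. P (set (init_seg \<mu> s)) j"
      unfolding P_def by eventually_elim (use j sub in \<open>unfold P_def, blast\<close>)
    \<comment> \<open>The first two ways to fail \<open>P\<close> hold at every stage; in the third,
      \<open>x\<close> eventually appears and refutes \<open>k\<close>. Only finitely many
      \<open>k\<close> lie below \<open>j\<close>, so one bound serves all.\<close>
    have "\<forall>\<^sub>F s in sequentially. \<not> P (set (init_seg \<mu> s)) k" if "k < j" for k
    proof -
      have "\<not> P (W \<phi> e) k" using that not_less_Least unfolding j_def by blast
      then consider "W \<phi> k \<notin> K" | "\<not> F k \<subseteq> W \<phi> e" | x where "x \<in> W \<phi> e" "x \<notin> W \<phi> k"
        by (auto simp: P_def)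
      then show ?thesis
      proof cases
        case 3
        show ?thesis
          using enum[OF 3(1)] by eventually_elim (use 3 in \<open>auto simp: P_def\<close>)
      next
        case 2
        have "\<not> P (set (init_seg \<mu> s)) k" for s
          using 2 sub[of s] unfolding P_def by blast
        then show ?thesis by simp
      qed (simp add: P_def)
    qed
    then have "\<forall>\<^sub>F s in sequentially. \<forall>k\<in>{..<j}. \<not> P (set (init_seg \<mu> s)) k"
      by (intro eventually_ball_finite) auto
    with valid have "\<forall>\<^sub>F s in sequentially. M (init_seg \<mu> s) = j"
      unfolding M_def
      by eventually_elim (metis (no_types) Least_equality lessThan_iff not_less)
    with \<open>(j, e) \<in> E\<close> show ?thesis by blast
  qed
  then show ?thesis unfolding learnable_def by blast
qed

theorem proposition3p5:
  fixes \<phi> :: "nat \<Rightarrow> nat \<rightharpoonup> nat"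
    and E :: "nat rel"
    and K :: "nat set set"
  assumes "acceptable \<phi>"
    and "equiv UNIV E"
    and "ce_eq \<phi> \<subseteq> E"
    and "\<forall>A\<in>K. A \<noteq> {} \<and> ce A"
  shows "learnable \<phi> E K \<longleftrightarrow> \<not> (\<exists>e. W \<phi> e \<in> K \<and> absorbing \<phi> E K e)"
proof
  assume "learnable \<phi> E K"
  then show "\<not> (\<exists>e. W \<phi> e \<in> K \<and> absorbing \<phi> E K e)"
    using learnable_imp_not_absorbing assms(2,4) by blast
next
  assume "\<not> (\<exists>e. W \<phi> e \<in> K \<and> absorbing \<phi> E K e)"
  then have "\<not> absorbing \<phi> E K e" for e
    by (auto simp: absorbing_def)
  then show "learnable \<phi> E K"
    using not_absorbing_imp_learnable assms(2,3) by blast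
qed

end
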